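(* Let $\theta\in\mathbb{R}\setminus\mathbb{Q}$, let $(m,n)\in\mathbb{Z}^2$, and let $w=\lambda U^mV^n$ with $\lambda\in\mathbb{C}$, $|\lambda|=1$. Suppose $\phi:A_\theta\to A_\theta$ is a harmonic map. Then $\operatorname{Ad}w\circ\phi$ is also a harmonic map.
   Context: For irrational $\theta$, $A_\theta$ is the universal $C^*$-algebra generated by two unitaries $U,V$ with $UV=e^{2\pi i\theta}VU$; $\tau$ is its canonical tracial state, and $A_\theta^\infty$ is the smooth dense subalgebra (elements $\sum a_{m,n}U^mV^n$ with rapidly decreasing coefficients). $\delta_1,\delta_2$ are the $*$-derivations of $A_\theta^\infty$ determined by $\delta_1(U)=2\pi iU$, $\delta_1(V)=0$, $\delta_2(U)=0$, $\delta_2(V)=2\pi iV$. $\operatorname{Ad}w$ is the inner automorphism $a\mapsto waw^*$. A unital $*$-endomorphism $\phi$ of $A_\theta$ with $\phi(U),\phi(V)\in A_\theta^\infty$ is a harmonic map if it satisfies the Euler-Lagrange equations: for all self-adjoint $A,B\in A_\theta$ with $A-\phi(V)^*A\phi(V)=B-\phi(U)^*B\phi(U)$ one has $$\sum_{j=1}^2\Big\{\tau\big(A\,\delta_j[\phi(U)^*\delta_j(\phi(U))]\big)+\tau\big(B\,\delta_j[\phi(V)^*\delta_j(\phi(V))]\big)\Big\}=0.$$ *)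

theory Defs
  imports "HOL-Analysis.Analysis"
begin

section \<open>Unital C*-algebras\<close>

class cstar_algebra = real_normed_algebra_1 + banach +
  fixes cscale :: "complex \<Rightarrow> 'a \<Rightarrow> 'a" (infixr "*\<^sub>c" 75)
    and star :: "'a \<Rightarrow> 'a" ("_\<^sup>\<star>" [1000] 999)
  assumes cscale_of_real: "complex_of_real r *\<^sub>c x = r *\<^sub>R x"
    and cscale_add_right: "c *\<^sub>c (x + y) = c *\<^sub>c x + c *\<^sub>c y"
    and cscale_add_left: "(c + d) *\<^sub>c x = c *\<^sub>c x + d *\<^sub>c x"
    and cscale_cscale: "c *\<^sub>c (d *\<^sub>c x) = (c * d) *\<^sub>c x"
    and mult_cscale_left: "(c *\<^sub>c x) * y = c *\<^sub>c (x * y)"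
    and mult_cscale_right: "x * (c *\<^sub>c y) = c *\<^sub>c (x * y)"
    and norm_cscale: "norm (c *\<^sub>c x) = cmod c * norm x"
    and star_star: "(x\<^sup>\<star>)\<^sup>\<star> = x"
    and star_add: "(x + y)\<^sup>\<star> = x\<^sup>\<star> + y\<^sup>\<star>"
    and star_mult: "(x * y)\<^sup>\<star> = y\<^sup>\<star> * x\<^sup>\<star>"
    and star_cscale: "(c *\<^sub>c x)\<^sup>\<star> = cnj c *\<^sub>c x\<^sup>\<star>"
    and cstar_identity: "norm (x\<^sup>\<star> * x) = (norm x)\<^sup>2"

text \<open>The same notion for explicit operations on a carrier set. It is needed because a universal
  property quantifies over C*-algebras inside a formula, where type classes cannot be quantified.\<close>

locale cstar_algebra_on =
  fixes S :: "'b set"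
    and add :: "'b \<Rightarrow> 'b \<Rightarrow> 'b" (infixl "\<oplus>" 65)
    and zero :: 'b ("\<zero>")
    and scale :: "complex \<Rightarrow> 'b \<Rightarrow> 'b" (infixr "\<odot>" 75)
    and mult :: "'b \<Rightarrow> 'b \<Rightarrow> 'b" (infixl "\<otimes>" 70)
    and one :: 'b ("\<one>")
    and adj :: "'b \<Rightarrow> 'b"
    and nrm :: "'b \<Rightarrow> real"
  assumes closed_ops: "\<zero> \<in> S" "\<one> \<in> S"
      "\<And>x y. \<lbrakk>x \<in> S; y \<in> S\<rbrakk> \<Longrightarrow> x \<oplus> y \<in> S"
      "\<And>x y. \<lbrakk>x \<in> S; y \<in> S\<rbrakk> \<Longrightarrow> x \<otimes> y \<in> S"
      "\<And>c x. x \<in> S \<Longrightarrow> c \<odot> x \<in> S"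
      "\<And>x. x \<in> S \<Longrightarrow> adj x \<in> S"
    and vector_space:
      "\<And>x y z. \<lbrakk>x \<in> S; y \<in> S; z \<in> S\<rbrakk> \<Longrightarrow> (x \<oplus> y) \<oplus> z = x \<oplus> (y \<oplus> z)"
      "\<And>x y. \<lbrakk>x \<in> S; y \<in> S\<rbrakk> \<Longrightarrow> x \<oplus> y = y \<oplus> x"
      "\<And>x. x \<in> S \<Longrightarrow> \<zero> \<oplus> x = x"
      "\<And>x. x \<in> S \<Longrightarrow> x \<oplus> ((-1) \<odot> x) = \<zero>"
      "\<And>x. x \<in> S \<Longrightarrow> 1 \<odot> x = x"
      "\<And>c d x. x \<in> S \<Longrightarrow> c \<odot> (d \<odot> x) = (c * d) \<odot> x"
      "\<And>c x y. \<lbrakk>x \<in> S; y \<in> S\<rbrakk> \<Longrightarrow> c \<odot> (x \<oplus> y) = (c \<odot> x) \<oplus> (c \<odot> y)"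
      "\<And>c d x. x \<in> S \<Longrightarrow> (c + d) \<odot> x = (c \<odot> x) \<oplus> (d \<odot> x)"
    and unital_algebra:
      "\<And>x y z. \<lbrakk>x \<in> S; y \<in> S; z \<in> S\<rbrakk> \<Longrightarrow> (x \<otimes> y) \<otimes> z = x \<otimes> (y \<otimes> z)"
      "\<And>x. x \<in> S \<Longrightarrow> \<one> \<otimes> x = x"
      "\<And>x. x \<in> S \<Longrightarrow> x \<otimes> \<one> = x"
      "\<And>x y z. \<lbrakk>x \<in> S; y \<in> S; z \<in> S\<rbrakk> \<Longrightarrow> x \<otimes> (y \<oplus> z) = (x \<otimes> y) \<oplus> (x \<otimes> z)"
      "\<And>x y z. \<lbrakk>x \<in> S; y \<in> S; z \<in> S\<rbrakk> \<Longrightarrow> (x \<oplus> y) \<otimes> z = (x \<otimes> z) \<oplus> (y \<otimes> z)"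
      "\<And>c x y. \<lbrakk>x \<in> S; y \<in> S\<rbrakk> \<Longrightarrow> (c \<odot> x) \<otimes> y = c \<odot> (x \<otimes> y)"
      "\<And>c x y. \<lbrakk>x \<in> S; y \<in> S\<rbrakk> \<Longrightarrow> x \<otimes> (c \<odot> y) = c \<odot> (x \<otimes> y)"
    and involution:
      "\<And>x. x \<in> S \<Longrightarrow> adj (adj x) = x"
      "\<And>x y. \<lbrakk>x \<in> S; y \<in> S\<rbrakk> \<Longrightarrow> adj (x \<oplus> y) = adj x \<oplus> adj y"
      "\<And>x y. \<lbrakk>x \<in> S; y \<in> S\<rbrakk> \<Longrightarrow> adj (x \<otimes> y) = adj y \<otimes> adj x"
      "\<And>c x. x \<in> S \<Longrightarrow> adj (c \<odot> x) = cnj c \<odot> adj x"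
    and cstar_norm:
      "\<And>x. x \<in> S \<Longrightarrow> 0 \<le> nrm x"
      "\<And>x. x \<in> S \<Longrightarrow> nrm x = 0 \<longleftrightarrow> x = \<zero>"
      "\<And>x y. \<lbrakk>x \<in> S; y \<in> S\<rbrakk> \<Longrightarrow> nrm (x \<oplus> y) \<le> nrm x + nrm y"
      "\<And>c x. x \<in> S \<Longrightarrow> nrm (c \<odot> x) = cmod c * nrm x"
      "\<And>x y. \<lbrakk>x \<in> S; y \<in> S\<rbrakk> \<Longrightarrow> nrm (x \<otimes> y) \<le> nrm x * nrm y"
      "\<And>x. x \<in> S \<Longrightarrow> nrm (adj x \<otimes> x) = (nrm x)\<^sup>2"
    and complete:
      "\<And>X :: nat \<Rightarrow> 'b. \<lbrakk>\<And>k. X k \<in> S;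
          \<And>e. 0 < e \<Longrightarrow> \<exists>N. \<forall>i\<ge>N. \<forall>j\<ge>N. nrm (X i \<oplus> ((-1) \<odot> X j)) < e\<rbrakk>
        \<Longrightarrow> \<exists>x\<in>S. (\<lambda>k. nrm (X k \<oplus> ((-1) \<odot> x))) \<longlonglongrightarrow> 0"

lemma cscale_one: "1 *\<^sub>c (x :: 'a::cstar_algebra) = x"
  using cscale_of_real[of 1 x] by simp

lemma cscale_minus_one: "(-1) *\<^sub>c (x :: 'a::cstar_algebra) = - x"
  using cscale_of_real[of "-1" x] by simp

lemma cstar_algebra_on_UNIV:
  "cstar_algebra_on (UNIV :: 'a::cstar_algebra set) (+) 0 (*\<^sub>c) (*) 1 star norm"
proof
  fix X :: "nat \<Rightarrow> 'a"
  assume "\<And>e. 0 < e \<Longrightarrow> \<exists>N. \<forall>i\<ge>N. \<forall>j\<ge>N. norm (X i + (-1) *\<^sub>c X j) < e"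
  then have "Cauchy X"
    by (auto simp: Cauchy_iff cscale_minus_one)
  then obtain x where "X \<longlonglongrightarrow> x"
    using Cauchy_convergent convergent_def by blast
  then have "(\<lambda>k. norm (X k + (-1) *\<^sub>c x)) \<longlonglongrightarrow> 0"
    by (simp add: cscale_minus_one LIM_zero tendsto_norm_zero)
  then show "\<exists>x\<in>UNIV. (\<lambda>k. norm (X k + (-1) *\<^sub>c x)) \<longlonglongrightarrow> 0"
    by blast
qed (simp_all add: cscale_one cscale_minus_one cscale_cscale cscale_add_left cscale_add_right
      mult_cscale_left mult_cscale_right star_star star_add star_mult star_cscale norm_cscale
      cstar_identity norm_mult_ineq norm_triangle_ineq algebra_simps)

definition unitary :: "'a::cstar_algebra \<Rightarrow> bool" where
  "unitary u \<longleftrightarrow> u\<^sup>\<star> * u = 1 \<and> u * u\<^sup>\<star> = 1"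

definition self_adjoint :: "'a::cstar_algebra \<Rightarrow> bool" where
  "self_adjoint x \<longleftrightarrow> x\<^sup>\<star> = x"

text \<open>Integer powers of a unitary, whose inverse is its adjoint.\<close>

definition upow :: "'a::cstar_algebra \<Rightarrow> int \<Rightarrow> 'a" (infixr "\<up>" 80) where
  "u \<up> k = (if 0 \<le> k then u ^ nat k else (u\<^sup>\<star>) ^ nat (- k))"

definition unital_star_endomorphism :: "('a::cstar_algebra \<Rightarrow> 'a) \<Rightarrow> bool" where
  "unital_star_endomorphism \<phi> \<longleftrightarrow>
     (\<forall>x y. \<phi> (x + y) = \<phi> x + \<phi> y) \<and> (\<forall>c x. \<phi> (c *\<^sub>c x) = c *\<^sub>c \<phi> x) \<and>
     (\<forall>x y. \<phi> (x * y) = \<phi> x * \<phi> y) \<and> (\<forall>x. \<phi> (x\<^sup>\<star>) = (\<phi> x)\<^sup>\<star>) \<and> \<phi> 1 = 1"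

definition Ad :: "'a::cstar_algebra \<Rightarrow> 'a \<Rightarrow> 'a" where
  "Ad w a = w * a * w\<^sup>\<star>"

definition generates_cstar :: "'a::cstar_algebra set \<Rightarrow> bool" where
  "generates_cstar G \<longleftrightarrow>
     (\<forall>C. G \<subseteq> C \<and> closed C \<and> 1 \<in> C \<and> (\<forall>x\<in>C. \<forall>y\<in>C. x + y \<in> C) \<and> (\<forall>c. \<forall>x\<in>C. c *\<^sub>c x \<in> C) \<and>
          (\<forall>x\<in>C. \<forall>y\<in>C. x * y \<in> C) \<and> (\<forall>x\<in>C. x\<^sup>\<star> \<in> C) \<longrightarrow> C = UNIV)"

section \<open>The rotation algebra\<close>

text \<open>The ambient type is the universal C*-algebra generated by two unitaries subject to
  \<open>U V = e\<^sup>2\<^sup>\<pi>\<^sup>i\<^sup>\<theta> V U\<close>. The universal property is tested on C*-algebras whose carrier is a set of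
  reals. This loses nothing: the elements \<open>u, v\<close> of any C*-algebra generate a separable
  C*-subalgebra, which has at most the cardinality of the continuum and is therefore isomorphic to
  one of these. Uniqueness of \<open>\<pi>\<close> follows from generation by \<open>U\<close> and \<open>V\<close>.\<close>

definition rotation_algebra :: "real \<Rightarrow> 'a::cstar_algebra \<Rightarrow> 'a \<Rightarrow> bool" where
  "rotation_algebra \<theta> U V \<longleftrightarrow>
     unitary U \<and> unitary V \<and> U * V = exp (2 * of_real pi * \<i> * of_real \<theta>) *\<^sub>c (V * U) \<and>
     generates_cstar {U, V} \<and>
     (\<forall>(S :: real set) add zero scale mult one adj nrm u v.
        cstar_algebra_on S add zero scale mult one adj nrm \<and> u \<in> S \<and> v \<in> S \<and>
        mult (adj u) u = one \<and> mult u (adj u) = one \<and> mult (adj v) v = one \<and> mult v (adj v) = one \<and>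
        mult u v = scale (exp (2 * of_real pi * \<i> * of_real \<theta>)) (mult v u) \<longrightarrow>
        (\<exists>\<pi> :: 'a \<Rightarrow> real.
           (\<forall>x. \<pi> x \<in> S) \<and> (\<forall>x y. \<pi> (x + y) = add (\<pi> x) (\<pi> y)) \<and>
           (\<forall>c x. \<pi> (c *\<^sub>c x) = scale c (\<pi> x)) \<and> (\<forall>x y. \<pi> (x * y) = mult (\<pi> x) (\<pi> y)) \<and>
           (\<forall>x. \<pi> (x\<^sup>\<star>) = adj (\<pi> x)) \<and> \<pi> 1 = one \<and> \<pi> U = u \<and> \<pi> V = v))"

definition tracial_state :: "('a::cstar_algebra \<Rightarrow> complex) \<Rightarrow> bool" where
  "tracial_state \<tau> \<longleftrightarrow>
     (\<forall>x y. \<tau> (x + y) = \<tau> x + \<tau> y) \<and> (\<forall>c x. \<tau> (c *\<^sub>c x) = c * \<tau> x) \<and>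
     (\<forall>x. \<tau> (x\<^sup>\<star> * x) \<in> \<real>\<^sub>\<ge>\<^sub>0) \<and> \<tau> 1 = 1 \<and> (\<forall>x y. \<tau> (x * y) = \<tau> (y * x))"

definition canonical_trace :: "'a::cstar_algebra \<Rightarrow> 'a \<Rightarrow> ('a \<Rightarrow> complex) \<Rightarrow> bool" where
  "canonical_trace U V \<tau> \<longleftrightarrow> tracial_state \<tau> \<and>
     (\<forall>m n. \<tau> (U \<up> m * V \<up> n) = (if m = 0 \<and> n = 0 then 1 else 0))"

definition rapidly_decreasing :: "(int \<times> int \<Rightarrow> complex) \<Rightarrow> bool" where
  "rapidly_decreasing a \<longleftrightarrow>
     (\<forall>k::nat. \<exists>C::real. \<forall>m n. (1 + \<bar>of_int m\<bar> + \<bar>of_int n\<bar>) ^ k * cmod (a (m, n)) \<le> C)"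

definition smooth_subalgebra :: "'a::cstar_algebra \<Rightarrow> 'a \<Rightarrow> 'a set" where
  "smooth_subalgebra U V = {x. \<exists>a. rapidly_decreasing a \<and>
     ((\<lambda>(m, n). a (m, n) *\<^sub>c (U \<up> m * V \<up> n)) has_sum x) UNIV}"

definition star_derivation_on :: "'a::cstar_algebra set \<Rightarrow> ('a \<Rightarrow> 'a) \<Rightarrow> bool" where
  "star_derivation_on D d \<longleftrightarrow>
     (\<forall>x\<in>D. d x \<in> D) \<and>
     (\<forall>x\<in>D. \<forall>y\<in>D. d (x + y) = d x + d y) \<and> (\<forall>c. \<forall>x\<in>D. d (c *\<^sub>c x) = c *\<^sub>c d x) \<and>
     (\<forall>x\<in>D. \<forall>y\<in>D. d (x * y) = d x * y + x * d y) \<and> (\<forall>x\<in>D. d (x\<^sup>\<star>) = (d x)\<^sup>\<star>)"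

text \<open>Only the indices 1 and 2 and the values on the smooth subalgebra matter.\<close>

definition canonical_derivations ::
    "'a::cstar_algebra \<Rightarrow> 'a \<Rightarrow> (nat \<Rightarrow> 'a \<Rightarrow> 'a) \<Rightarrow> bool" where
  "canonical_derivations U V \<delta> \<longleftrightarrow>
     star_derivation_on (smooth_subalgebra U V) (\<delta> 1) \<and>
     star_derivation_on (smooth_subalgebra U V) (\<delta> 2) \<and>
     \<delta> 1 U = (2 * of_real pi * \<i>) *\<^sub>c U \<and> \<delta> 1 V = 0 \<and>
     \<delta> 2 U = 0 \<and> \<delta> 2 V = (2 * of_real pi * \<i>) *\<^sub>c V"

definition harmonic_map ::
    "'a::cstar_algebra \<Rightarrow> 'a \<Rightarrow> ('a \<Rightarrow> complex) \<Rightarrow> (nat \<Rightarrow> 'a \<Rightarrow> 'a) \<Rightarrow> ('a \<Rightarrow> 'a) \<Rightarrow> bool" where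
  "harmonic_map U V \<tau> \<delta> \<phi> \<longleftrightarrow>
     unital_star_endomorphism \<phi> \<and>
     \<phi> U \<in> smooth_subalgebra U V \<and> \<phi> V \<in> smooth_subalgebra U V \<and>
     (\<forall>A B. self_adjoint A \<and> self_adjoint B \<and>
        A - (\<phi> V)\<^sup>\<star> * A * \<phi> V = B - (\<phi> U)\<^sup>\<star> * B * \<phi> U \<longrightarrow>
        (\<Sum>j = 1..2. \<tau> (A * \<delta> j ((\<phi> U)\<^sup>\<star> * \<delta> j (\<phi> U))) + \<tau> (B * \<delta> j ((\<phi> V)\<^sup>\<star> * \<delta> j (\<phi> V)))) = 0)"

end

theory Submission
  imports Defs
begin

text \<open>
  The monomial \<open>w\<close> is a common eigenvector of the two derivations, with purely imaginary eigenvalues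
  \<open>c\<^sub>j\<close>: these are \<open>2\<pi>im\<close> and \<open>2\<pi>in\<close>. Hence
  \<open>\<delta>\<^sub>j(w x w\<^sup>\<star>) = c\<^sub>j w x w\<^sup>\<star> + w \<delta>\<^sub>j(x) w\<^sup>\<star> - c\<^sub>j w x w\<^sup>\<star>\<close>, so that \<open>Ad w\<close> commutes with
  \<open>\<delta>\<^sub>j\<close> on smooth elements (\<open>deriv_Ad\<close>). Consequently the expressions
  \<open>\<delta>\<^sub>j[\<phi>(U)\<^sup>\<star> \<delta>\<^sub>j(\<phi>(U))]\<close> in the Euler-Lagrange equations are merely conjugated by \<open>w\<close> when \<open>\<phi>\<close> is
  replaced by \<open>Ad w \<circ> \<phi>\<close>. Since \<open>\<tau>\<close> is a trace, that conjugation can be moved onto the test elements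
  \<open>A\<close> and \<open>B\<close>; the substitution \<open>A \<mapsto> w\<^sup>\<star> A w\<close>, \<open>B \<mapsto> w\<^sup>\<star> B w\<close> carries admissible pairs for
  \<open>Ad w \<circ> \<phi>\<close> to admissible pairs for \<open>\<phi>\<close>, and the equations for \<open>\<phi>\<close> apply.

  The analytic content lies in the Leibniz rule, which is available only for elements of the smooth
  subalgebra: it has to be shown that products and adjoints of sums \<open>\<Sum> a(m,n) U\<^sup>m V\<^sup>n\<close> with rapidly
  decreasing coefficients are again of this form (\<open>smooth_mult\<close>, \<open>smooth_star\<close>). Monomials multiply
  like the group \<open>\<int>\<^sup>2\<close> up to a scalar of modulus 1, so a product has as coefficients a
  convolution twisted by phases, and rapid decay is inherited because the weight
  \<open>1 + |m| + |n|\<close> is submultiplicative (\<open>rapidly_decreasing_convolution\<close>).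
\<close>

section \<open>Unitaries in a C*-algebra\<close>

lemma cscale_zero_left [simp]: "0 *\<^sub>c (x :: 'a::cstar_algebra) = 0"
  using cscale_of_real[of 0 x] by simp

lemma cscale_minus_left: "(- c) *\<^sub>c (x :: 'a::cstar_algebra) = - (c *\<^sub>c x)"
  using cscale_add_left[of c "- c" x] by (simp add: eq_neg_iff_add_eq_0 add.commute)

lemma bounded_linear_cscale_right: "bounded_linear (\<lambda>x :: 'a::cstar_algebra. c *\<^sub>c x)"
proof (rule bounded_linear_intro)
  fix r and x :: 'a
  show "c *\<^sub>c (r *\<^sub>R x) = r *\<^sub>R (c *\<^sub>c x)"
    by (simp add: cscale_of_real[symmetric] cscale_cscale mult.commute)
  show "norm (c *\<^sub>c x) \<le> norm x * cmod c"
    by (simp add: norm_cscale mult.commute)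
qed (rule cscale_add_right)

lemma bounded_linear_cscale_left: "bounded_linear (\<lambda>c. c *\<^sub>c (x :: 'a::cstar_algebra))"
proof (rule bounded_linear_intro)
  fix r and c :: complex
  show "(r *\<^sub>R c) *\<^sub>c x = r *\<^sub>R (c *\<^sub>c x)"
    by (simp add: cscale_of_real[symmetric] cscale_cscale scaleR_conv_of_real)
  show "norm (c *\<^sub>c x) \<le> norm c * norm x"
    by (simp add: norm_cscale)
qed (rule cscale_add_left)

text \<open>The C*-identity bounds \<open>\<parallel>y\<parallel>\<^sup>2\<close> by \<open>\<parallel>y\<^sup>\<star>\<parallel> \<parallel>y\<parallel>\<close>; the reverse inequality is the same one at \<open>y\<^sup>\<star>\<close>.
  Continuity of the adjoint is what allows it to be applied to infinite sums term by term.\<close>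

lemma norm_star: "norm (x\<^sup>\<star>) = norm (x :: 'a::cstar_algebra)"
proof -
  have le: "norm y \<le> norm (y\<^sup>\<star>)" for y :: 'a
    using cstar_identity[of y] norm_mult_ineq[of "y\<^sup>\<star>" y]
    by (cases "norm y = 0") (auto simp: power2_eq_square mult_le_cancel_right)
  show ?thesis
    using le[of x] le[of "x\<^sup>\<star>"] by (simp add: star_star)
qed

lemma bounded_linear_star: "bounded_linear (star :: 'a::cstar_algebra \<Rightarrow> 'a)"
proof (rule bounded_linear_intro[where K = 1])
  fix r and x :: 'a
  show "(r *\<^sub>R x)\<^sup>\<star> = r *\<^sub>R (x\<^sup>\<star>)"
    by (simp add: cscale_of_real[symmetric] star_cscale)
qed (simp_all add: star_add norm_star)

lemma star_one [simp]: "(1 :: 'a::cstar_algebra)\<^sup>\<star> = 1"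
  by (metis mult.left_neutral mult.right_neutral star_mult star_star)

lemma unitary_one [simp]: "unitary 1"
  by (simp add: unitary_def)

lemma unitary_star: "unitary u \<Longrightarrow> unitary (u\<^sup>\<star>)"
  by (simp add: unitary_def star_star)

lemma unitary_cancel:
  assumes "unitary u"
  shows "u\<^sup>\<star> * u = 1" "u * u\<^sup>\<star> = 1" "u\<^sup>\<star> * (u * x) = x" "u * (u\<^sup>\<star> * x) = x"
  using assms by (simp_all add: unitary_def mult.assoc[symmetric])

lemma unitary_mult: "unitary u \<Longrightarrow> unitary v \<Longrightarrow> unitary (u * v)"
  by (simp add: unitary_def star_mult mult.assoc) (simp add: unitary_def mult.assoc[symmetric])

lemma unitary_power: "unitary u \<Longrightarrow> unitary (u ^ k)"
  by (induction k) (simp_all add: unitary_mult)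

lemma unitary_upow: "unitary u \<Longrightarrow> unitary (u \<up> k)"
  by (simp add: upow_def unitary_power unitary_star)

lemma unitary_cscale: "cmod c = 1 \<Longrightarrow> unitary u \<Longrightarrow> unitary (c *\<^sub>c u)"
  by (simp add: unitary_def star_cscale mult_cscale_left mult_cscale_right cscale_cscale cscale_one
      complex_norm_square[symmetric] mult.commute[of "cnj c"])

lemma norm_unitary: "unitary (u :: 'a::cstar_algebra) \<Longrightarrow> norm u = 1"
  using cstar_identity[of u] power2_eq_1_iff[of "norm u"] norm_ge_zero[of u]
  by (auto simp: unitary_def)

lemma upow_simps [simp]: "u \<up> 0 = 1" "u \<up> 1 = u"
  by (simp_all add: upow_def)

lemma upow_Suc:
  assumes "unitary u"
  shows "u \<up> (k + 1) = u * u \<up> k"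
proof (cases "0 \<le> k")
  case True
  then show ?thesis by (simp add: upow_def nat_add_distrib)
next
  case False
  then have "nat (- k) = Suc (nat (- (k + 1)))" by simp
  with False show ?thesis
    by (cases "k = -1") (simp_all add: upow_def unitary_cancel[OF assms])
qed

lemma upow_add:
  assumes "unitary u"
  shows "u \<up> (k + l) = u \<up> k * u \<up> l"
proof (induction k rule: int_induct[where k = 0])
  case base
  show ?case by simp
next
  case (step1 i)
  then show ?case
    using upow_Suc[OF assms, of i] upow_Suc[OF assms, of "i + l"]
    by (simp add: mult.assoc algebra_simps)
next
  case (step2 i)
  have "u * u \<up> (i - 1 + l) = u * (u \<up> (i - 1) * u \<up> l)"
    using step2 upow_Suc[OF assms, of "i - 1"] upow_Suc[OF assms, of "i - 1 + l"]
    by (simp add: mult.assoc[symmetric])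
  then have "u\<^sup>\<star> * (u * u \<up> (i - 1 + l)) = u\<^sup>\<star> * (u * (u \<up> (i - 1) * u \<up> l))"
    by simp
  then show ?case by (simp add: unitary_cancel[OF assms])
qed

lemma star_upow:
  assumes "unitary u"
  shows "(u \<up> k)\<^sup>\<star> = u \<up> (- k)"
proof -
  have "(u \<up> k)\<^sup>\<star> = (u \<up> k)\<^sup>\<star> * (u \<up> k * u \<up> (- k))"
    using upow_add[OF assms, of k "- k"] by simp
  then show ?thesis
    by (simp add: unitary_cancel[OF unitary_upow[OF assms]])
qed

text \<open>For the norm estimates only the modulus of the commutation factor matters, so the factor is
  kept existential; this avoids the bookkeeping of the exponents \<open>e\<^sup>2\<^sup>\<pi>\<^sup>i\<^sup>\<theta>\<^sup>p\<^sup>q\<close>.\<close>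

definition phase_commute :: "'a::cstar_algebra \<Rightarrow> 'a \<Rightarrow> bool" where
  "phase_commute x y \<longleftrightarrow> (\<exists>c. cmod c = 1 \<and> x * y = c *\<^sub>c (y * x))"

lemma phase_commute_sym: "phase_commute x y \<Longrightarrow> phase_commute y x"
  unfolding phase_commute_def
proof (elim exE conjE)
  fix c assume c: "cmod c = 1" "x * y = c *\<^sub>c (y * x)"
  then have "y * x = cnj c *\<^sub>c (x * y)"
    by (simp add: cscale_cscale cscale_one complex_norm_square[symmetric] mult.commute[of "cnj c"])
  with c show "\<exists>c. cmod c = 1 \<and> y * x = c *\<^sub>c (x * y)"
    by (intro exI[of _ "cnj c"]) simp
qed

lemma phase_commute_mult:
  assumes "phase_commute x y" "phase_commute x z"
  shows "phase_commute x (y * z)"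
proof -
  obtain c d where c: "cmod c = 1" "x * y = c *\<^sub>c (y * x)" and d: "cmod d = 1" "x * z = d *\<^sub>c (z * x)"
    using assms by (auto simp: phase_commute_def)
  have "x * (y * z) = c *\<^sub>c (y * (x * z))"
    by (simp add: c(2) mult.assoc[symmetric] mult_cscale_left)
  also have "\<dots> = (c * d) *\<^sub>c (y * z * x)"
    by (simp add: d(2) mult_cscale_right cscale_cscale mult.assoc)
  finally show ?thesis
    unfolding phase_commute_def using c d by (intro exI[of _ "c * d"]) (simp add: norm_mult)
qed

lemma phase_commute_star:
  assumes "phase_commute x u" "unitary u"
  shows "phase_commute x (u\<^sup>\<star>)"
proof -
  obtain c where c: "cmod c = 1" "u * x = c *\<^sub>c (x * u)"
    using phase_commute_sym[OF assms(1)] by (auto simp: phase_commute_def)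
  have "x * u\<^sup>\<star> = u\<^sup>\<star> * (u * x) * u\<^sup>\<star>"
    by (simp only: unitary_cancel[OF assms(2)])
  also have "\<dots> = c *\<^sub>c (u\<^sup>\<star> * x)"
    by (simp add: c mult_cscale_left mult_cscale_right mult.assoc unitary_cancel[OF assms(2)])
  finally show ?thesis
    using c by (auto simp: phase_commute_def)
qed

lemma phase_commute_power: "phase_commute x y \<Longrightarrow> phase_commute x (y ^ k)"
proof (induction k)
  case 0
  show ?case by (auto simp: phase_commute_def cscale_one intro!: exI[of _ 1])
qed (simp add: phase_commute_mult)

lemma phase_commute_upow: "phase_commute x u \<Longrightarrow> unitary u \<Longrightarrow> phase_commute x (u \<up> k)"
  by (simp add: upow_def phase_commute_power phase_commute_star)

section \<open>Rapidly decreasing coefficients\<close>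

definition weight :: "int \<times> int \<Rightarrow> real" where
  "weight s = 1 + \<bar>of_int (fst s)\<bar> + \<bar>of_int (snd s)\<bar>"

lemma weight_ge_1: "1 \<le> weight s"
  by (simp add: weight_def)

lemma weight_uminus [simp]: "weight (- s) = weight s"
  by (simp add: weight_def)

text \<open>Submultiplicativity is \<open>(weight s - 1) * (weight t - 1) \<ge> 0\<close> combined with the triangle
  inequality.\<close>

lemma weight_add: "weight (s + t) \<le> weight s * weight t"
proof -
  have "weight (s + t) \<le> weight s + weight t - 1"
    by (simp add: weight_def)
  moreover have "0 \<le> (weight s - 1) * (weight t - 1)"
    using weight_ge_1[of s] weight_ge_1[of t] by simp
  ultimately show ?thesis by (simp add: algebra_simps)
qed

lemma rapidly_decreasing_iff:
  "rapidly_decreasing a \<longleftrightarrow> (\<forall>k. \<exists>C. \<forall>s. weight s ^ k * cmod (a s) \<le> C)"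
  by (simp add: rapidly_decreasing_def weight_def)

lemma summable_on_int_inverse_square: "(\<lambda>m::int. 1 / (1 + \<bar>real_of_int m\<bar>)\<^sup>2) summable_on UNIV"
proof -
  let ?f = "\<lambda>m::int. 1 / (1 + \<bar>real_of_int m\<bar>)\<^sup>2"
  have sq: "summable (\<lambda>n. 1 / (1 + real n)\<^sup>2)"
    using inverse_squares_sums by (simp add: sums_iff add.commute)
  have "(\<lambda>n. ?f (int n)) summable_on UNIV"
    using sq by (subst summable_on_UNIV_nonneg_real_iff) auto
  then have nonneg: "?f summable_on range int"
    by (subst summable_on_reindex) (auto simp: o_def)
  have "(\<lambda>n. ?f (- int n)) summable_on UNIV"
    using sq by (subst summable_on_UNIV_nonneg_real_iff) auto
  then have "?f summable_on range (\<lambda>n. - int n)"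
    by (subst summable_on_reindex) (auto simp: o_def inj_on_def)
  then have "?f summable_on (range (\<lambda>n. - int n) - range int)"
    by (rule summable_on_subset_banach) auto
  then have "?f summable_on (range int \<union> (range (\<lambda>n. - int n) - range int))"
    by (rule summable_on_Un_disjoint[OF nonneg]) auto
  moreover have "range int \<union> (range (\<lambda>n. - int n) - range int) = UNIV"
  proof -
    have "m \<in> range int \<or> m \<in> range (\<lambda>n. - int n)" for m
      by (cases m rule: int_cases2) auto
    then show ?thesis by auto
  qed
  ultimately show ?thesis by simp
qed

text \<open>The exponent 4 makes the lattice sum split into a product of two one-dimensional sums of
  inverse squares, because the weight dominates both \<open>1 + |m|\<close> and \<open>1 + |n|\<close>.\<close>

lemma summable_on_inverse_weight: "(\<lambda>s. 1 / weight s ^ 4) summable_on UNIV"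
proof -
  let ?f = "\<lambda>m::int. 1 / (1 + \<bar>real_of_int m\<bar>)\<^sup>2"
  have "(\<lambda>(m, n). ?f m * ?f n) summable_on UNIV \<times> UNIV"
  proof (rule summable_on_SigmaI)
    show "((\<lambda>n. (case (m, n) of (m, n) \<Rightarrow> ?f m * ?f n)) has_sum ?f m * infsum ?f UNIV) UNIV" for m
      using has_sum_cmult_right[OF has_sum_infsum[OF summable_on_int_inverse_square], of "?f m"] by simp
    show "(\<lambda>m. ?f m * infsum ?f UNIV) summable_on UNIV"
      by (rule summable_on_cmult_left[OF summable_on_int_inverse_square])
  qed auto
  then have "(\<lambda>(m, n). ?f m * ?f n) summable_on UNIV"
    by simp
  then show ?thesis
  proof (rule summable_on_comparison_test)
    fix s :: "int \<times> int"
    obtain m n where s: "s = (m, n)" by (cases s)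
    let ?M = "1 + \<bar>real_of_int m\<bar>" and ?N = "1 + \<bar>real_of_int n\<bar>"
    have "?M\<^sup>2 * ?N\<^sup>2 \<le> weight s ^ 2 * weight s ^ 2"
      by (intro mult_mono power_mono) (auto simp: s weight_def)
    then have "1 / (weight s ^ 2 * weight s ^ 2) \<le> 1 / (?M\<^sup>2 * ?N\<^sup>2)"
      by (rule divide_left_mono) (auto simp: zero_less_mult_iff s weight_def add_pos_nonneg)
    then show "1 / weight s ^ 4 \<le> (case s of (m, n) \<Rightarrow> ?f m * ?f n)"
      by (simp add: s power_add[symmetric])
    show "0 \<le> 1 / weight s ^ 4"
      using weight_ge_1[of s] by simp
  qed
qed

text \<open>Rapid decay only bounds weighted coefficients; spending four extra powers of the weight turns
  the bound into summability.\<close>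

lemma rapidly_decreasing_summable:
  assumes "rapidly_decreasing a"
  shows "(\<lambda>s. weight s ^ k * cmod (a s)) summable_on UNIV"
proof -
  obtain C where C: "\<And>s. weight s ^ (k + 4) * cmod (a s) \<le> C"
    using assms unfolding rapidly_decreasing_iff by blast
  show ?thesis
  proof (rule summable_on_comparison_test)
    show "(\<lambda>s. C * (1 / weight s ^ 4)) summable_on UNIV"
      by (rule summable_on_cmult_right[OF summable_on_inverse_weight])
    fix s
    have pos: "0 < weight s"
      using weight_ge_1[of s] by simp
    show "weight s ^ k * cmod (a s) \<le> C * (1 / weight s ^ 4)"
      using C[of s] pos by (simp add: pos_le_divide_eq power_add mult_ac)
    show "0 \<le> weight s ^ k * cmod (a s)"
      using pos by simp
  qed
qed

text \<open>By submultiplicativity, \<open>weight r ^ k\<close> can be split into \<open>weight s ^ k\<close>, absorbed by the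
  summability of \<open>a\<close>, and \<open>weight (r - s) ^ k\<close>, absorbed by the bound on \<open>b\<close>. The factor \<open>\<kappa>\<close> is the
  phase produced by reordering \<open>U\<close> and \<open>V\<close>.\<close>

lemma rapidly_decreasing_convolution:
  assumes a: "rapidly_decreasing a" and b: "rapidly_decreasing b"
    and \<kappa>: "\<And>r s. cmod (\<kappa> r s) \<le> 1"
  shows "rapidly_decreasing (\<lambda>r. \<Sum>\<^sub>\<infinity>s. a s * b (r - s) * \<kappa> r s)"
    and "(\<lambda>s. a s * b (r - s) * \<kappa> r s) summable_on UNIV"
proof -
  have bound: "weight r ^ k * cmod (a s * b (r - s) * \<kappa> r s) \<le> C * (weight s ^ k * cmod (a s))"
    if C: "\<And>s. weight s ^ k * cmod (b s) \<le> C" for k C r s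
  proof -
    have "weight r ^ k \<le> (weight s * weight (r - s)) ^ k"
      using weight_add[of s "r - s"] weight_ge_1[of r] by (intro power_mono) auto
    then have "weight r ^ k * cmod (a s * b (r - s) * \<kappa> r s)
        \<le> (weight s * weight (r - s)) ^ k * (cmod (a s) * cmod (b (r - s)) * 1)"
      unfolding norm_mult using \<kappa>[of r s] weight_ge_1[of s] weight_ge_1[of "r - s"]
      by (intro mult_mono) auto
    also have "\<dots> = (weight s ^ k * cmod (a s)) * (weight (r - s) ^ k * cmod (b (r - s)))"
      by (simp add: power_mult_distrib mult_ac)
    also have "\<dots> \<le> (weight s ^ k * cmod (a s)) * C"
      using weight_ge_1[of s] by (intro mult_left_mono C) auto
    finally show ?thesis by (simp add: mult.commute)
  qed
  have abs_summable: "(\<lambda>s. cmod (a s * b (r - s) * \<kappa> r s)) summable_on UNIV" for r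
  proof -
    obtain C where C: "\<And>s. weight s ^ 0 * cmod (b s) \<le> C"
      using b unfolding rapidly_decreasing_iff by blast
    show ?thesis
      using bound[OF C, of r]
      by (intro Infinite_Sum.abs_summable_on_comparison_test'
            [OF summable_on_cmult_right[OF rapidly_decreasing_summable[OF a, of 0], of C]]) auto
  qed
  then show "(\<lambda>s. a s * b (r - s) * \<kappa> r s) summable_on UNIV"
    by (rule abs_summable_summable)
  show "rapidly_decreasing (\<lambda>r. \<Sum>\<^sub>\<infinity>s. a s * b (r - s) * \<kappa> r s)"
    unfolding rapidly_decreasing_iff
  proof
    fix k
    obtain C where C: "\<And>s. weight s ^ k * cmod (b s) \<le> C"
      using b unfolding rapidly_decreasing_iff by blast
    have "weight r ^ k * cmod (\<Sum>\<^sub>\<infinity>s. a s * b (r - s) * \<kappa> r s)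
        \<le> (\<Sum>\<^sub>\<infinity>s. C * (weight s ^ k * cmod (a s)))" for r
    proof -
      have "weight r ^ k * cmod (\<Sum>\<^sub>\<infinity>s. a s * b (r - s) * \<kappa> r s)
          \<le> weight r ^ k * (\<Sum>\<^sub>\<infinity>s. cmod (a s * b (r - s) * \<kappa> r s))"
        using weight_ge_1[of r] by (intro mult_left_mono norm_infsum_bound abs_summable) auto
      also have "\<dots> = (\<Sum>\<^sub>\<infinity>s. weight r ^ k * cmod (a s * b (r - s) * \<kappa> r s))"
        by (rule infsum_cmult_right'[symmetric])
      also have "\<dots> \<le> (\<Sum>\<^sub>\<infinity>s. C * (weight s ^ k * cmod (a s)))"
        by (intro infsum_mono bound[OF C] summable_on_cmult_right abs_summable
            rapidly_decreasing_summable a)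
      finally show ?thesis .
    qed
    then show "\<exists>C. \<forall>r. weight r ^ k * cmod (\<Sum>\<^sub>\<infinity>s. a s * b (r - s) * \<kappa> r s) \<le> C"
      by blast
  qed
qed

section \<open>The smooth subalgebra\<close>

locale phase_commuting_unitaries =
  fixes U V :: "'a::cstar_algebra"
  assumes unitary_U: "unitary U" and unitary_V: "unitary V" and phase_commute: "phase_commute U V"
begin

definition monomial :: "int \<times> int \<Rightarrow> 'a" where
  "monomial s = U \<up> fst s * V \<up> snd s"

lemma unitary_monomial: "unitary (monomial s)"
  by (simp add: monomial_def unitary_mult unitary_upow unitary_U unitary_V)

lemma norm_monomial [simp]: "norm (monomial s) = 1"
  by (rule norm_unitary[OF unitary_monomial])

lemma phase_commute_upow_upow: "phase_commute (V \<up> q) (U \<up> p)"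
  by (intro phase_commute_upow phase_commute_sym[OF phase_commute_upow]
      phase_commute unitary_U unitary_V)

text \<open>Monomials form a projective representation of \<open>\<int>\<^sup>2\<close>. The cocycle is obtained as a function
  because it enters the coefficients of products.\<close>

lemma monomial_mult_phase:
  obtains \<kappa> where "\<And>s t. cmod (\<kappa> s t) = 1"
    and "\<And>s t. monomial s * monomial t = \<kappa> s t *\<^sub>c monomial (s + t)"
proof -
  have "\<exists>c. cmod c = 1 \<and> monomial s * monomial t = c *\<^sub>c monomial (s + t)" for s t
  proof -
    obtain c where c: "cmod c = 1" "V \<up> snd s * U \<up> fst t = c *\<^sub>c (U \<up> fst t * V \<up> snd s)"
      using phase_commute_upow_upow by (auto simp: phase_commute_def)
    have "monomial s * monomial t = U \<up> fst s * (V \<up> snd s * U \<up> fst t) * V \<up> snd t"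
      by (simp add: monomial_def mult.assoc)
    also have "\<dots> = c *\<^sub>c monomial (s + t)"
      by (simp add: c monomial_def mult_cscale_left mult_cscale_right mult.assoc
          upow_add[OF unitary_U] upow_add[OF unitary_V])
    finally show ?thesis using c by blast
  qed
  then show thesis using that by metis
qed

lemma star_monomial_phase:
  obtains \<kappa> where "\<And>s. cmod (\<kappa> s) = 1" and "\<And>s. (monomial s)\<^sup>\<star> = \<kappa> s *\<^sub>c monomial (- s)"
proof -
  have "\<exists>c. cmod c = 1 \<and> (monomial s)\<^sup>\<star> = c *\<^sub>c monomial (- s)" for s
    using phase_commute_upow_upow[of "- snd s" "- fst s"]
    by (simp add: monomial_def star_mult star_upow unitary_U unitary_V phase_commute_def)
  then show thesis using that by metis
qed

lemma smooth_iff: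
  "x \<in> smooth_subalgebra U V \<longleftrightarrow>
     (\<exists>a. rapidly_decreasing a \<and> ((\<lambda>s. a s *\<^sub>c monomial s) has_sum x) UNIV)"
  by (simp add: smooth_subalgebra_def monomial_def case_prod_unfold)

lemma smooth_monomial: "monomial t \<in> smooth_subalgebra U V"
proof -
  let ?a = "\<lambda>s. if s = t then 1 else 0 :: complex"
  have "rapidly_decreasing ?a"
    unfolding rapidly_decreasing_iff
    using weight_ge_1[of t] by (auto intro!: exI[of _ "weight t ^ k" for k])
  moreover have "((\<lambda>s. ?a s *\<^sub>c monomial s) has_sum monomial t) UNIV"
    by (rule has_sum_finite_neutralI[of "{t}"]) (auto simp: cscale_one)
  ultimately show ?thesis
    unfolding smooth_iff by (intro exI[of _ ?a] conjI)
qed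

lemma smooth_U: "U \<in> smooth_subalgebra U V"
  using smooth_monomial[of "(1, 0)"] by (simp add: monomial_def)

lemma smooth_V: "V \<in> smooth_subalgebra U V"
  using smooth_monomial[of "(0, 1)"] by (simp add: monomial_def)

lemma smooth_one: "1 \<in> smooth_subalgebra U V"
  using smooth_monomial[of "(0, 0)"] by (simp add: monomial_def)

lemma smooth_cscale:
  assumes "x \<in> smooth_subalgebra U V"
  shows "c *\<^sub>c x \<in> smooth_subalgebra U V"
proof -
  obtain a where a: "rapidly_decreasing a" "((\<lambda>s. a s *\<^sub>c monomial s) has_sum x) UNIV"
    using assms smooth_iff by blast
  have "rapidly_decreasing (\<lambda>s. c * a s)"
    unfolding rapidly_decreasing_iff
  proof
    fix k
    obtain C where C: "\<And>s. weight s ^ k * cmod (a s) \<le> C"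
      using a(1) unfolding rapidly_decreasing_iff by blast
    have "weight s ^ k * cmod (c * a s) \<le> cmod c * C" for s
      using mult_left_mono[OF C[of s], of "cmod c"] by (simp add: norm_mult mult_ac)
    then show "\<exists>C. \<forall>s. weight s ^ k * cmod (c * a s) \<le> C" by blast
  qed
  moreover have "((\<lambda>s. (c * a s) *\<^sub>c monomial s) has_sum c *\<^sub>c x) UNIV"
    using has_sum_bounded_linear[OF bounded_linear_cscale_right a(2)] by (simp add: cscale_cscale)
  ultimately show ?thesis unfolding smooth_iff by blast
qed

lemma smooth_star:
  assumes "x \<in> smooth_subalgebra U V"
  shows "x\<^sup>\<star> \<in> smooth_subalgebra U V"
proof -
  obtain a where a: "rapidly_decreasing a" "((\<lambda>s. a s *\<^sub>c monomial s) has_sum x) UNIV"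
    using assms smooth_iff by blast
  obtain \<kappa> where \<kappa>: "\<And>s. cmod (\<kappa> s) = 1" "\<And>s. (monomial s)\<^sup>\<star> = \<kappa> s *\<^sub>c monomial (- s)"
    using star_monomial_phase by blast
  define b where "b = (\<lambda>s. cnj (a (- s)) * \<kappa> (- s))"
  have "rapidly_decreasing b"
    unfolding rapidly_decreasing_iff
  proof
    fix k
    obtain C where C: "\<And>s. weight s ^ k * cmod (a s) \<le> C"
      using a(1) unfolding rapidly_decreasing_iff by blast
    have "weight s ^ k * cmod (b s) \<le> C" for s
      using C[of "- s"] by (simp add: b_def norm_mult \<kappa>)
    then show "\<exists>C. \<forall>s. weight s ^ k * cmod (b s) \<le> C" by blast
  qed
  moreover have "((\<lambda>s. b (- s) *\<^sub>c monomial (- s)) has_sum x\<^sup>\<star>) UNIV"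
    using has_sum_bounded_linear[OF bounded_linear_star a(2)]
    by (simp add: b_def star_cscale \<kappa> cscale_cscale)
  then have "((\<lambda>s. b s *\<^sub>c monomial s) has_sum x\<^sup>\<star>) UNIV"
    by (subst (asm) has_sum_reindex_bij_witness[where i = uminus and j = uminus and T = UNIV
          and s' = "x\<^sup>\<star>" and h = "\<lambda>s. b s *\<^sub>c monomial s"]) auto
  ultimately show ?thesis unfolding smooth_iff by blast
qed

text \<open>The product is expanded into an absolutely convergent double sum over \<open>(s, t)\<close>, which is
  regrouped along \<open>r = s + t\<close>; the inner sums are the coefficients of a twisted convolution.\<close>

lemma smooth_mult:
  assumes x: "x \<in> smooth_subalgebra U V" and y: "y \<in> smooth_subalgebra U V"
  shows "x * y \<in> smooth_subalgebra U V"
proof -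
  obtain a where a: "rapidly_decreasing a" "((\<lambda>s. a s *\<^sub>c monomial s) has_sum x) UNIV"
    using x smooth_iff by blast
  obtain b where b: "rapidly_decreasing b" "((\<lambda>s. b s *\<^sub>c monomial s) has_sum y) UNIV"
    using y smooth_iff by blast
  obtain \<kappa> where \<kappa>: "\<And>s t. cmod (\<kappa> s t) = 1"
      "\<And>s t. monomial s * monomial t = \<kappa> s t *\<^sub>c monomial (s + t)"
    using monomial_mult_phase by blast
  let ?f = "\<lambda>(s, t). (a s *\<^sub>c monomial s) * (b t *\<^sub>c monomial t)"
  let ?g = "\<lambda>r s. a s * b (r - s) * \<kappa> s (r - s)"
  let ?c = "\<lambda>r. \<Sum>\<^sub>\<infinity>s. ?g r s"
  have cmod_summable: "(\<lambda>s. cmod (d s)) summable_on UNIV" if "rapidly_decreasing d" for d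
    using rapidly_decreasing_summable[OF that, of 0] by simp
  have double: "(?f has_sum x * y) (UNIV \<times> UNIV)"
  proof (rule has_sum_SigmaI)
    show "((\<lambda>t. ?f (s, t)) has_sum (a s *\<^sub>c monomial s) * y) UNIV" for s
      using has_sum_bounded_linear[OF bounded_linear_mult_right b(2)] by simp
    show "((\<lambda>s. (a s *\<^sub>c monomial s) * y) has_sum x * y) UNIV"
      using has_sum_bounded_linear[OF bounded_linear_mult_left a(2)] .
    have "(\<lambda>(s, t). cmod (a s) * cmod (b t)) summable_on UNIV \<times> UNIV"
    proof (rule summable_on_SigmaI)
      show "((\<lambda>t. case (s, t) of (s, t) \<Rightarrow> cmod (a s) * cmod (b t)) has_sum
          cmod (a s) * (\<Sum>\<^sub>\<infinity>t. cmod (b t))) UNIV" for s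
        using has_sum_cmult_right[OF has_sum_infsum[OF cmod_summable[OF b(1)]]] by simp
      show "(\<lambda>s. cmod (a s) * (\<Sum>\<^sub>\<infinity>t. cmod (b t))) summable_on UNIV"
        by (rule summable_on_cmult_left[OF cmod_summable[OF a(1)]])
    qed auto
    then have "(\<lambda>p. norm (?f p)) summable_on UNIV \<times> UNIV"
    proof (rule Infinite_Sum.abs_summable_on_comparison_test', clarify)
      fix s t
      show "norm (a s *\<^sub>c monomial s * b t *\<^sub>c monomial t) \<le> cmod (a s) * cmod (b t)"
        using norm_mult_ineq[of "a s *\<^sub>c monomial s" "b t *\<^sub>c monomial t"]
        by (simp add: norm_cscale)
    qed
    then show "?f summable_on UNIV \<times> UNIV"
      by (rule abs_summable_summable)
  qed
  have "((\<lambda>(r, s). ?g r s *\<^sub>c monomial r) has_sum x * y) (UNIV \<times> UNIV)"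
  proof (rule iffD1[OF has_sum_reindex_bij_witness double])
    fix p :: "(int \<times> int) \<times> (int \<times> int)"
    show "(\<lambda>(r, s). (s, r - s)) ((\<lambda>(s, t). (s + t, s)) p) = p"
      and "(\<lambda>(s, t). (s + t, s)) ((\<lambda>(r, s). (s, r - s)) p) = p"
      by (auto split: prod.splits)
    show "(\<lambda>(r, s). ?g r s *\<^sub>c monomial r) ((\<lambda>(s, t). (s + t, s)) p) = ?f p"
      by (simp add: case_prod_unfold mult_cscale_left mult_cscale_right cscale_cscale \<kappa> mult_ac)
  qed auto
  then have "((\<lambda>r. ?c r *\<^sub>c monomial r) has_sum x * y) UNIV"
  proof (rule has_sum_SigmaD)
    fix r
    have "(?g r has_sum ?c r) UNIV"
      by (intro has_sum_infsum rapidly_decreasing_convolution(2) a b) (simp add: \<kappa>)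
    then show "((\<lambda>s. (\<lambda>(r, s). ?g r s *\<^sub>c monomial r) (r, s)) has_sum ?c r *\<^sub>c monomial r) UNIV"
      using has_sum_bounded_linear[OF bounded_linear_cscale_left] by fastforce
  qed
  moreover have "rapidly_decreasing ?c"
    by (intro rapidly_decreasing_convolution(1) a b) (simp add: \<kappa>)
  ultimately show ?thesis unfolding smooth_iff by blast
qed

end

section \<open>Derivations and inner automorphisms\<close>

text \<open>The Leibniz rule for a derivation on \<open>D\<close> is usable only on products formed inside \<open>D\<close>, hence
  the closure hypotheses.\<close>

locale star_derivation =
  fixes D :: "'a::cstar_algebra set" and d :: "'a \<Rightarrow> 'a"
  assumes derivation: "star_derivation_on D d"
    and one_closed: "1 \<in> D"
    and mult_closed: "x \<in> D \<Longrightarrow> y \<in> D \<Longrightarrow> x * y \<in> D"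
    and star_closed: "x \<in> D \<Longrightarrow> x\<^sup>\<star> \<in> D"
    and cscale_closed: "x \<in> D \<Longrightarrow> c *\<^sub>c x \<in> D"
begin

lemma deriv_closed: "x \<in> D \<Longrightarrow> d x \<in> D"
  and deriv_cscale: "x \<in> D \<Longrightarrow> d (c *\<^sub>c x) = c *\<^sub>c d x"
  and deriv_mult: "x \<in> D \<Longrightarrow> y \<in> D \<Longrightarrow> d (x * y) = d x * y + x * d y"
  and deriv_star: "x \<in> D \<Longrightarrow> d (x\<^sup>\<star>) = (d x)\<^sup>\<star>"
  using derivation by (auto simp: star_derivation_on_def)

definition eigenvector :: "complex \<Rightarrow> 'a \<Rightarrow> bool" where
  "eigenvector c x \<longleftrightarrow> x \<in> D \<and> d x = c *\<^sub>c x"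

lemma eigenvector_one: "eigenvector 0 1"
  using deriv_mult[OF one_closed one_closed] one_closed by (simp add: eigenvector_def)

lemma eigenvector_mult: "eigenvector c x \<Longrightarrow> eigenvector e y \<Longrightarrow> eigenvector (c + e) (x * y)"
  by (simp add: eigenvector_def mult_closed deriv_mult mult_cscale_left mult_cscale_right
      cscale_add_left)

lemma eigenvector_cscale: "eigenvector c x \<Longrightarrow> eigenvector c (e *\<^sub>c x)"
  by (simp add: eigenvector_def cscale_closed deriv_cscale cscale_cscale mult.commute)

lemma eigenvector_star: "eigenvector c x \<Longrightarrow> eigenvector (cnj c) (x\<^sup>\<star>)"
  by (simp add: eigenvector_def star_closed deriv_star star_cscale)

lemma eigenvector_power: "eigenvector c x \<Longrightarrow> eigenvector (of_nat k * c) (x ^ k)"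
  by (induction k) (auto simp: eigenvector_one distrib_right dest: eigenvector_mult)

text \<open>Negative powers are powers of the adjoint, whose eigenvalue is \<open>cnj c\<close>; imaginary \<open>c\<close> makes this
  the eigenvalue \<open>- c\<close> of an inverse.\<close>

lemma eigenvector_upow:
  assumes "eigenvector c x" and "cnj c = - c"
  shows "eigenvector (of_int k * c) (x \<up> k)"
  using eigenvector_power[OF assms(1), of "nat k"]
    eigenvector_power[OF eigenvector_star[OF assms(1)], of "nat (- k)"] assms(2)
  by (auto simp: upow_def)

text \<open>The contributions \<open>c\<close> of \<open>w\<close> and \<open>cnj c = - c\<close> of \<open>w\<^sup>\<star>\<close> to the Leibniz rule cancel.\<close>

lemma deriv_Ad:
  assumes w: "eigenvector c w" and c: "cnj c = - c" and x: "x \<in> D"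
  shows "d (Ad w x) = Ad w (d x)"
proof -
  have w': "w \<in> D" "d w = c *\<^sub>c w" "w\<^sup>\<star> \<in> D" "d (w\<^sup>\<star>) = (- c) *\<^sub>c w\<^sup>\<star>"
    using w eigenvector_star[OF w] c by (auto simp: eigenvector_def)
  have "d (Ad w x) = (c *\<^sub>c w * x + w * d x) * w\<^sup>\<star> + w * x * (- c) *\<^sub>c w\<^sup>\<star>"
    using w' x by (simp add: Ad_def deriv_mult mult_closed)
  then show ?thesis
    by (simp add: Ad_def distrib_right mult_cscale_left mult_cscale_right cscale_minus_left)
qed

end

lemma Ad_mult: "unitary w \<Longrightarrow> Ad w (x * y) = Ad w x * Ad w y"
  by (simp add: Ad_def mult.assoc unitary_cancel)

lemma Ad_star: "Ad w (x\<^sup>\<star>) = (Ad w x)\<^sup>\<star>"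
  by (simp add: Ad_def star_mult star_star mult.assoc)

lemma Ad_diff: "Ad w (x - y) = Ad w x - Ad w y"
  by (simp add: Ad_def algebra_simps)

lemma Ad_star_Ad:
  assumes "unitary w"
  shows "Ad (w\<^sup>\<star>) (Ad w x) = x"
proof -
  have "Ad (w\<^sup>\<star>) (Ad w x) = w\<^sup>\<star> * (w * (x * (w\<^sup>\<star> * w)))"
    by (simp only: Ad_def star_star mult.assoc)
  then show ?thesis by (simp only: unitary_cancel[OF assms] mult_1_right)
qed

lemma self_adjoint_Ad: "self_adjoint x \<Longrightarrow> self_adjoint (Ad w x)"
  by (simp add: self_adjoint_def Ad_star[symmetric])

lemma unital_star_endomorphism_Ad_comp:
  assumes "unital_star_endomorphism \<phi>" and "unitary w"
  shows "unital_star_endomorphism (Ad w \<circ> \<phi>)"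
  using assms(1)
  by (simp add: unital_star_endomorphism_def Ad_mult[OF assms(2)] Ad_star)
    (simp add: Ad_def algebra_simps mult_cscale_left mult_cscale_right unitary_cancel[OF assms(2)])

lemma trace_Ad:
  assumes "tracial_state \<tau>" and "unitary w"
  shows "\<tau> (Ad w x) = \<tau> x"
proof -
  have "\<tau> (Ad w x) = \<tau> (w\<^sup>\<star> * (w * x))"
    using assms(1) by (simp add: Ad_def tracial_state_def)
  then show ?thesis by (simp add: unitary_cancel[OF assms(2)])
qed

theorem theorem3p6:
  fixes \<theta> :: real and U V :: "'a::cstar_algebra" and \<tau> :: "'a \<Rightarrow> complex"
    and \<delta> :: "nat \<Rightarrow> 'a \<Rightarrow> 'a" and m n :: int and z :: complex and w :: 'a and \<phi> :: "'a \<Rightarrow> 'a"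
  assumes "\<theta> \<notin> \<rat>"
    and "rotation_algebra \<theta> U V"
    and "canonical_trace U V \<tau>"
    and "canonical_derivations U V \<delta>"
    and "cmod z = 1"
    and "w = z *\<^sub>c (U \<up> m * V \<up> n)"
    and "harmonic_map U V \<tau> \<delta> \<phi>"
  shows "harmonic_map U V \<tau> \<delta> (Ad w \<circ> \<phi>)"
proof -
  let ?D = "smooth_subalgebra U V"
  let ?i = "2 * of_real pi * \<i>"
  interpret phase_commuting_unitaries U V
  proof
    have "cmod (exp (?i * of_real \<theta>)) = 1"
      by simp
    moreover have "U * V = exp (?i * of_real \<theta>) *\<^sub>c (V * U)"
      using assms(2) unfolding rotation_algebra_def by (elim conjE)
    ultimately show "phase_commute U V"
      unfolding phase_commute_def by blast
    show "unitary U" "unitary V"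
      using assms(2) unfolding rotation_algebra_def by - (elim conjE, assumption)+
  qed
  have \<tau>: "tracial_state \<tau>"
    using assms(3) by (simp add: canonical_trace_def)
  have unitary_w: "unitary w"
    by (simp add: assms(5,6) unitary_cscale unitary_mult unitary_upow unitary_U unitary_V)
  have der: "star_derivation ?D (\<delta> j)" if "j \<in> {1..2}" for j
  proof -
    have "j = 1 \<or> j = 2" using that by auto
    then show ?thesis
      using assms(4) by unfold_locales
        (auto simp: canonical_derivations_def smooth_one smooth_mult smooth_star smooth_cscale)
  qed
  have eigen_w: "\<exists>c. cnj c = - c \<and> star_derivation.eigenvector ?D (\<delta> j) c w" if "j \<in> {1..2}" for j
  proof -
    interpret star_derivation ?D "\<delta> j" by (rule der[OF that])
    have eigen: "\<exists>p q. cnj p = - p \<and> cnj q = - q \<and> eigenvector p U \<and> eigenvector q V"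
    proof -
      have "j = 1 \<or> j = 2" using that by auto
      then show ?thesis
      proof
        assume "j = 1"
        then have "eigenvector ?i U \<and> eigenvector 0 V"
          using assms(4) smooth_U smooth_V unfolding eigenvector_def
            by (simp add: canonical_derivations_def)
        then show ?thesis by (intro exI[of _ ?i] exI[of _ 0]) simp
      next
        assume "j = 2"
        then have "eigenvector 0 U \<and> eigenvector ?i V"
          using assms(4) smooth_U smooth_V unfolding eigenvector_def
            by (simp add: canonical_derivations_def)
        then show ?thesis by (intro exI[of _ ?i] exI[of _ 0]) simp
      qed
    qed
    then obtain p q where pq: "cnj p = - p" "cnj q = - q" "eigenvector p U" "eigenvector q V"
      by blast
    have "eigenvector (of_int m * p + of_int n * q) w"
      unfolding assms(6) by (intro eigenvector_cscale eigenvector_mult eigenvector_upow pq)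
    then show ?thesis
      using pq by (intro exI[of _ "of_int m * p + of_int n * q"]) simp
  qed
  have w_smooth: "w \<in> ?D"
    by (simp add: assms(6) smooth_cscale smooth_monomial[unfolded monomial_def, of "(m, n)", simplified])
  have Ad_smooth: "Ad w x \<in> ?D" if "x \<in> ?D" for x
    using that w_smooth by (simp add: Ad_def smooth_mult smooth_star)
  have \<delta>_Ad: "\<delta> j (Ad w x) = Ad w (\<delta> j x)" if "j \<in> {1..2}" "x \<in> ?D" for j x
  proof -
    interpret star_derivation ?D "\<delta> j" by (rule der[OF that(1)])
    show ?thesis using eigen_w[OF that(1)] deriv_Ad that(2) by blast
  qed
  \<comment> \<open>The terms of the Euler-Lagrange equations are conjugated by \<open>w\<close>.\<close>
  have current_Ad: "\<delta> j ((Ad w x)\<^sup>\<star> * \<delta> j (Ad w x)) = Ad w (\<delta> j (x\<^sup>\<star> * \<delta> j x))"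
    if "j \<in> {1..2}" "x \<in> ?D" for j x
  proof -
    interpret star_derivation ?D "\<delta> j" by (rule der[OF that(1)])
    have "(Ad w x)\<^sup>\<star> * \<delta> j (Ad w x) = Ad w (x\<^sup>\<star> * \<delta> j x)"
      by (simp add: \<delta>_Ad[OF that] Ad_star[symmetric] Ad_mult[OF unitary_w])
    then show ?thesis
      using that by (simp add: \<delta>_Ad mult_closed star_closed deriv_closed)
  qed
  \<comment> \<open>By invariance of the trace, conjugation by \<open>w\<close> passes to the test element as its inverse.\<close>
  have pull: "\<tau> (A * Ad w x) = \<tau> (Ad (w\<^sup>\<star>) A * x)" for A x
    using trace_Ad[OF \<tau> unitary_star[OF unitary_w], of "A * Ad w x"]
    by (simp add: Ad_mult[OF unitary_star[OF unitary_w]] Ad_star_Ad[OF unitary_w])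
  have \<phi>: "unital_star_endomorphism \<phi>" "\<phi> U \<in> ?D" "\<phi> V \<in> ?D"
    and euler_lagrange: "\<And>A B. self_adjoint A \<Longrightarrow> self_adjoint B \<Longrightarrow>
        A - (\<phi> V)\<^sup>\<star> * A * \<phi> V = B - (\<phi> U)\<^sup>\<star> * B * \<phi> U \<Longrightarrow>
        (\<Sum>j = 1..2. \<tau> (A * \<delta> j ((\<phi> U)\<^sup>\<star> * \<delta> j (\<phi> U))) + \<tau> (B * \<delta> j ((\<phi> V)\<^sup>\<star> * \<delta> j (\<phi> V)))) = 0"
    using assms(7) by (auto simp: harmonic_map_def)
  show ?thesis
    unfolding harmonic_map_def
  proof (intro conjI allI impI; (elim conjE)?)
    show "unital_star_endomorphism (Ad w \<circ> \<phi>)"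
      by (rule unital_star_endomorphism_Ad_comp[OF \<phi>(1) unitary_w])
    show "(Ad w \<circ> \<phi>) U \<in> ?D" "(Ad w \<circ> \<phi>) V \<in> ?D"
      using \<phi> by (simp_all add: Ad_smooth)
  next
    fix A B
    assume sa: "self_adjoint A" "self_adjoint B"
      and eq: "A - ((Ad w \<circ> \<phi>) V)\<^sup>\<star> * A * (Ad w \<circ> \<phi>) V = B - ((Ad w \<circ> \<phi>) U)\<^sup>\<star> * B * (Ad w \<circ> \<phi>) U"
    let ?A = "Ad (w\<^sup>\<star>) A" and ?B = "Ad (w\<^sup>\<star>) B"
    \<comment> \<open>The admissibility relation for \<open>Ad w \<circ> \<phi>\<close> becomes the one for \<open>\<phi>\<close> after conjugation.\<close>
    have conj: "Ad (w\<^sup>\<star>) (C - (Ad w x)\<^sup>\<star> * C * Ad w x) = Ad (w\<^sup>\<star>) C - x\<^sup>\<star> * Ad (w\<^sup>\<star>) C * x" for C x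
      by (simp add: Ad_diff Ad_mult[OF unitary_star[OF unitary_w]] Ad_star[symmetric]
          Ad_star_Ad[OF unitary_w])
    have "?A - (\<phi> V)\<^sup>\<star> * ?A * \<phi> V = ?B - (\<phi> U)\<^sup>\<star> * ?B * \<phi> U"
      using arg_cong[OF eq, of "Ad (w\<^sup>\<star>)"] by (simp add: conj)
    then have "(\<Sum>j = 1..2. \<tau> (?A * \<delta> j ((\<phi> U)\<^sup>\<star> * \<delta> j (\<phi> U))) + \<tau> (?B * \<delta> j ((\<phi> V)\<^sup>\<star> * \<delta> j (\<phi> V)))) = 0"
      by (intro euler_lagrange self_adjoint_Ad sa)
    then show "(\<Sum>j = 1..2. \<tau> (A * \<delta> j (((Ad w \<circ> \<phi>) U)\<^sup>\<star> * \<delta> j ((Ad w \<circ> \<phi>) U))) +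
        \<tau> (B * \<delta> j (((Ad w \<circ> \<phi>) V)\<^sup>\<star> * \<delta> j ((Ad w \<circ> \<phi>) V)))) = 0"
      using \<phi> by (simp add: current_Ad pull cong: sum.cong_simp)
  qed
qed

end
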